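(* For every positive integer $n$ and every $1\le k\le 2n$, $B^*_{n,k}(t,q)=B^*_{n,2n+1-k}(t,q)$. In particular $B_{n,k}(1,q)=B_{n,2n+1-k}(1,q)$.
   Context: $B_n$ is the set of signed permutations $\pi=\pi_1\cdots\pi_n$ of $[n]$. Let $\operatorname{wex}(\pi)=\#\{i:\pi_i\ge i\}$, $\operatorname{neg}(\pi)=\#\{i:\pi_i<0\}$, $\operatorname{fwex}(\pi)=2\operatorname{wex}(\pi)+\operatorname{neg}(\pi)$. A crossing of $\pi$ is a pair $(i,j)$ with $i,j\in[n]$ such that $i<j\le\pi_i<\pi_j$, or $-i<j\le-\pi_i<\pi_j$, or $i>j>\pi_i>\pi_j$; $\operatorname{cro}(\pi)$ is their number. Define $B_{n,k}(t,q)=\sum_{\pi\in B_n,\ \operatorname{fwex}(\pi)=k}t^{\operatorname{neg}(\pi)}q^{\operatorname{cro}(\pi)}$ and $B^*_{n,k}(t,q)=\sum_{\pi\in B_n,\ \operatorname{fwex}(\pi)=k}t^{\operatorname{neg}(\pi)+\chi(\pi_1>0)}q^{\operatorname{cro}(\pi)}$, where $\chi(\pi_1>0)$ is $1$ if $\pi_1>0$ and $0$ otherwise. *)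

theory Defs
  imports
    "HOL-Combinatorics.Permutations"
    "HOL-Computational_Algebra.Polynomial"
begin

text \<open>
  The word \<open>\<pi>\<^sub>1 \<dots> \<pi>\<^sub>n\<close> is identified with the bijection of \<open>{-n, \<dots>, -1, 1, \<dots>, n}\<close> that sends
  \<open>i\<close> to \<open>\<pi>\<^sub>i\<close> and \<open>-i\<close> to \<open>-\<pi>\<^sub>i\<close>. Since \<open>permutes\<close> makes it the identity elsewhere, distinct
  elements of this set have distinct words.
\<close>

definition signed_perms :: "nat \<Rightarrow> (int \<Rightarrow> int) set" where
  "signed_perms n =
     {\<pi>. \<pi> permutes ({- int n..int n} - {0}) \<and> (\<forall>i. \<pi> (- i) = - \<pi> i)}"

lemma finite_signed_perms: "finite (signed_perms n)"
  by (rule finite_subset[OF _ finite_permutations[of "{- int n..int n} - {0}"]])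
     (auto simp: signed_perms_def)

definition wex :: "nat \<Rightarrow> (int \<Rightarrow> int) \<Rightarrow> nat" where
  "wex n \<pi> = card {i \<in> {1..int n}. \<pi> i \<ge> i}"

definition neg :: "nat \<Rightarrow> (int \<Rightarrow> int) \<Rightarrow> nat" where
  "neg n \<pi> = card {i \<in> {1..int n}. \<pi> i < 0}"

definition fwex :: "nat \<Rightarrow> (int \<Rightarrow> int) \<Rightarrow> nat" where
  "fwex n \<pi> = 2 * wex n \<pi> + neg n \<pi>"

definition crossings :: "nat \<Rightarrow> (int \<Rightarrow> int) \<Rightarrow> (int \<times> int) set" where
  "crossings n \<pi> =
     {(i, j). i \<in> {1..int n} \<and> j \<in> {1..int n} \<and>
        ((i < j \<and> j \<le> \<pi> i \<and> \<pi> i < \<pi> j) \<or>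
         (- i < j \<and> j \<le> - \<pi> i \<and> - \<pi> i < \<pi> j) \<or>
         (i > j \<and> j > \<pi> i \<and> \<pi> i > \<pi> j))}"

definition cro :: "nat \<Rightarrow> (int \<Rightarrow> int) \<Rightarrow> nat" where
  "cro n \<pi> = card (crossings n \<pi>)"

text \<open>
  Polynomials in \<open>t\<close> and \<open>q\<close> are elements of \<open>\<int>[q][t]\<close>: the outer variable is \<open>t\<close> and the
  coefficients are polynomials in \<open>q\<close>, so \<open>monom (monom 1 b) a\<close> is \<open>t\<^sup>a q\<^sup>b\<close>, and evaluating the
  outer polynomial at \<open>1\<close> is the substitution \<open>t = 1\<close>.
\<close>

definition B_poly :: "nat \<Rightarrow> nat \<Rightarrow> int poly poly" where
  "B_poly n k =
     (\<Sum>\<pi> \<in> {\<pi> \<in> signed_perms n. fwex n \<pi> = k}. monom (monom 1 (cro n \<pi>)) (neg n \<pi>))"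

definition B_star_poly :: "nat \<Rightarrow> nat \<Rightarrow> int poly poly" where
  "B_star_poly n k =
     (\<Sum>\<pi> \<in> {\<pi> \<in> signed_perms n. fwex n \<pi> = k}.
        monom (monom 1 (cro n \<pi>)) (neg n \<pi> + (if \<pi> 1 > 0 then 1 else 0)))"

end

theory Submission
  imports Defs
begin

text \<open>
  Changing the sign of \<open>\<pi>\<^sub>1\<close> preserves the crossings and lowers \<open>fwex\<close> by one when \<open>\<pi>\<^sub>1 > 0\<close>. Hence
  \<open>B\<^sup>*\<^sub>n\<^sub>,\<^sub>k = S\<^sub>k + S\<^sub>k\<^sub>+\<^sub>1\<close>, where \<open>S\<^sub>k\<close> sums over the \<open>\<pi>\<close> with \<open>\<pi>\<^sub>1 > 0\<close> and \<open>fwex \<pi> = k\<close>, and it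
  suffices that \<open>S\<^sub>k = S\<^sub>2\<^sub>n\<^sub>+\<^sub>2\<^sub>-\<^sub>k\<close>.

  Sort the \<open>\<pi>\<close> by the set \<open>U\<close> of positions with \<open>\<pi>\<^sub>i \<ge> i\<close> and the set \<open>V\<close> of values that are not
  taken at the other positions, so that \<open>wex = |U|\<close> and \<open>neg = |V| - |U|\<close>. For fixed \<open>(U, V)\<close> the
  sum of \<open>q\<^sup>c\<^sup>r\<^sup>o\<close> is a product of \<open>q\<close>-integers: match the elements of \<open>U\<close> with elements of \<open>V\<close>, then
  the remaining positions with the remaining values, those left over in \<open>V\<close> being taken with a
  minus sign. The product is expressed through \<open>p\<^sub>i = |{v \<in> V. v > i}| - |{u \<in> U. u > i}|\<close>, and it is
  invariant under the involution that, for \<open>1 \<le> i < n\<close>, exchanges \<open>i \<in> V \<and> i + 1 \<in> U\<close> with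
  \<open>i \<notin> V \<and> i + 1 \<notin> U\<close>. This involution preserves \<open>|V| - |U|\<close> and sends \<open>|U| + |V|\<close>, which is
  \<open>fwex\<close>, to \<open>2n + 2 - |U| - |V|\<close>.
\<close>

subsection \<open>Sums over matchings\<close>

definition qnum :: "'a::comm_semiring_1 \<Rightarrow> nat \<Rightarrow> 'a" where
  "qnum q m = (\<Sum>i<m. q ^ i)"

lemma bij_betw_rank:
  fixes A :: "'a::linorder set"
  assumes "finite A"
  shows "bij_betw (\<lambda>x. card {y \<in> A. y < x}) A {..<card A}"
proof -
  let ?r = "\<lambda>x. card {y \<in> A. y < x}"
  have less: "?r x < ?r y" if "x \<in> A" "x < y" for x y
    using that assms by (intro psubset_card_mono) auto
  have inj: "inj_on ?r A"
    by (rule linorder_inj_onI) (use less in \<open>fastforce+\<close>)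
  have "?r x < card A" if "x \<in> A" for x
    using that assms by (intro psubset_card_mono) auto
  then have "?r ` A \<subseteq> {..<card A}"
    by auto
  then have "?r ` A = {..<card A}"
    by (rule card_subset_eq[rotated]) (simp_all add: card_image[OF inj])
  with inj show ?thesis
    by (simp add: bij_betw_def)
qed

text \<open>When each choice costs the number of smaller candidates, all choices together contribute
  one \<open>q\<close>-integer. Both matching sums use this for the partner of a single
  element.\<close>

lemma sum_power_rank:
  fixes A :: "'a::linorder set"
  assumes "finite A"
  shows "(\<Sum>x\<in>A. q ^ card {y \<in> A. y < x}) = qnum q (card A)"
  unfolding qnum_def using bij_betw_rank[OF assms] by (rule sum.reindex_bij_betw)

section \<open>Upper and lower matchings and their crossings\<close>

definition upper_maps :: "int set \<Rightarrow> int set \<Rightarrow> (int \<Rightarrow> int) set" where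
  "upper_maps U V = {f \<in> U \<rightarrow>\<^sub>E V. inj_on f U \<and> (\<forall>u\<in>U. u \<le> f u)}"

text \<open>
  A crossing \<open>(i, j)\<close> of one of the first two kinds is recorded as the pair \<open>(j, \<bar>\<pi>\<^sub>i\<bar>)\<close>; a value
  \<open>v\<close> outside the image of \<open>f\<close> is one with \<open>- v\<close> in the word.
\<close>

definition upper_crossings :: "int set \<Rightarrow> int set \<Rightarrow> (int \<Rightarrow> int) \<Rightarrow> (int \<times> int) set" where
  "upper_crossings U V f =
     {(u, v). u \<in> U \<and> v \<in> V \<and> u \<le> v \<and> v < f u \<and> (\<forall>z\<in>U. f z = v \<longrightarrow> z < u)}"

text \<open>The set \<open>T\<close> may contain negative numbers: it will hold the signed letters
  at the positions that are not weak exceedances.\<close>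

definition lower_maps :: "int set \<Rightarrow> int set \<Rightarrow> (int \<Rightarrow> int) set" where
  "lower_maps D T = {g \<in> D \<rightarrow>\<^sub>E T. bij_betw g D T \<and> (\<forall>d\<in>D. g d < d)}"

definition lower_crossings :: "int set \<Rightarrow> (int \<Rightarrow> int) \<Rightarrow> (int \<times> int) set" where
  "lower_crossings D g = {(i, j). i \<in> D \<and> j \<in> D \<and> i > j \<and> j > g i \<and> g i > g j}"

lemma finite_upper_maps: "finite U \<Longrightarrow> finite V \<Longrightarrow> finite (upper_maps U V)"
  by (rule finite_subset[OF _ finite_PiE[of U "\<lambda>_. V"]]) (auto simp: upper_maps_def)

lemma finite_lower_maps: "finite D \<Longrightarrow> finite T \<Longrightarrow> finite (lower_maps D T)"
  by (rule finite_subset[OF _ finite_PiE[of D "\<lambda>_. T"]]) (auto simp: lower_maps_def)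

text \<open>
  Removing the largest start \<open>b\<close>, matched with \<open>v\<close>, loses one crossing for each value in \<open>{b..<v}\<close>,
  however the rest is matched.
\<close>

lemma card_upper_crossings_insert:
  assumes fin: "finite A" "finite V" and b: "\<And>a. a \<in> A \<Longrightarrow> a < b"
    and v: "v \<in> V" "b \<le> v" and f: "f \<in> upper_maps A (V - {v})"
  shows "card (upper_crossings (insert b A) V (f(b := v))) =
           card {y \<in> V. b \<le> y \<and> y < v} + card (upper_crossings A (V - {v}) f)"
proof -
  have nb: "b \<notin> A" using b by blast
  have "upper_crossings (insert b A) V (f(b := v)) =
        Pair b ` {y \<in> V. b \<le> y \<and> y < v} \<union> upper_crossings A (V - {v}) f"
  proof (intro equalityI subsetI)
    fix p assume p: "p \<in> upper_crossings (insert b A) V (f(b := v))"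
    obtain u y where uy: "p = (u, y)" by (cases p)
    show "p \<in> Pair b ` {y \<in> V. b \<le> y \<and> y < v} \<union> upper_crossings A (V - {v}) f"
    proof (cases "u = b")
      case True
      with p uy show ?thesis by (auto simp: upper_crossings_def)
    next
      case False
      with p uy have u: "u \<in> A" and "y \<noteq> v"
        using b[of u] by (auto simp: upper_crossings_def)
      with p uy nb False show ?thesis
        by (auto simp: upper_crossings_def split: if_splits)
    qed
  next
    fix p assume p: "p \<in> Pair b ` {y \<in> V. b \<le> y \<and> y < v} \<union> upper_crossings A (V - {v}) f"
    with b nb v show "p \<in> upper_crossings (insert b A) V (f(b := v))"
      by (auto simp: upper_crossings_def)
  qed
  moreover have "finite (upper_crossings A (V - {v}) f)"
    by (rule finite_subset[of _ "A \<times> V"]) (auto simp: upper_crossings_def fin)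
  moreover have "Pair b ` {y \<in> V. b \<le> y \<and> y < v} \<inter> upper_crossings A (V - {v}) f = {}"
    using nb by (auto simp: upper_crossings_def)
  ultimately show ?thesis
    using fin by (simp add: card_Un_disjoint card_image inj_on_def)
qed

text \<open>Starts are matched from the greatest down. Each start greater than \<open>u\<close> has
  already used a value above \<open>u\<close>, so the number of candidates for \<open>u\<close> is
  fixed, and the crossings due to \<open>u\<close> rank the chosen one. If no matching exists, some
  truncated difference is \<open>0\<close>, and \<open>qnum q 0 = 0\<close>.\<close>

lemma sum_upper_maps:
  fixes q :: "'a::comm_semiring_1"
  assumes "finite U" "finite V"
  shows "(\<Sum>f\<in>upper_maps U V. q ^ card (upper_crossings U V f)) =
         (\<Prod>u\<in>U. qnum q (card {v \<in> V. u \<le> v} - card {z \<in> U. u < z}))"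
  using assms
proof (induction U arbitrary: V rule: finite_linorder_max_induct)
  case empty
  then show ?case
    by (simp add: upper_maps_def upper_crossings_def)
next
  case (insert b A)
  have nb: "b \<notin> A" using insert by blast
  let ?Vb = "{v \<in> V. b \<le> v}"
  let ?P = "\<Prod>u\<in>A. qnum q (card {v \<in> V. u \<le> v} - card {z \<in> insert b A. u < z})"
  have "(\<Sum>f\<in>upper_maps (insert b A) V. q ^ card (upper_crossings (insert b A) V f)) =
        (\<Sum>(v, f)\<in>(SIGMA v:?Vb. upper_maps A (V - {v})).
           q ^ (card {y \<in> V. b \<le> y \<and> y < v} + card (upper_crossings A (V - {v}) f)))"
  proof (rule sum.reindex_bij_witness[where
        i = "\<lambda>(v, f). f(b := v)" and j = "\<lambda>f. (f b, restrict f A)"], goal_cases)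
    case (1 f)
    then show ?case using nb
      by (auto simp: upper_maps_def fun_eq_iff restrict_def PiE_def extensional_def)
  next
    case (2 f)
    then show ?case using nb
      by (auto simp: upper_maps_def PiE_def Pi_def inj_on_def)
  next
    case (3 p)
    then show ?case using nb
      by (auto simp: upper_maps_def fun_eq_iff restrict_def PiE_def extensional_def)
  next
    case (4 p)
    then obtain v f where p: "p = (v, f)" and v: "v \<in> V" "b \<le> v"
      and f: "f \<in> A \<rightarrow>\<^sub>E V - {v}" "inj_on f A" "\<And>u. u \<in> A \<Longrightarrow> u \<le> f u"
      by (auto simp: upper_maps_def)
    have "inj_on (f(b := v)) (insert b A)"
      using f nb by (auto simp: inj_on_def PiE_def Pi_def)
    moreover have "f(b := v) \<in> insert b A \<rightarrow>\<^sub>E V"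
      using f v by (auto simp: PiE_def Pi_def extensional_def)
    ultimately show ?case
      using p f v by (simp add: upper_maps_def)
  next
    case (5 f)
    have f': "restrict f A \<in> upper_maps A (V - {f b})"
      using 5 nb by (auto simp: upper_maps_def PiE_def Pi_def inj_on_def)
    have eq: "f = (restrict f A)(b := f b)"
      using 5 nb by (auto simp: upper_maps_def fun_eq_iff restrict_def PiE_def extensional_def)
    have "f b \<in> V" "b \<le> f b"
      using 5 by (auto simp: upper_maps_def PiE_def Pi_def)
    from card_upper_crossings_insert[OF insert(1) insert.prems insert(2)[rule_format] this f']
    show ?case using eq by simp
  qed
  also have "\<dots> = (\<Sum>v\<in>?Vb. \<Sum>f\<in>upper_maps A (V - {v}).
           q ^ (card {y \<in> V. b \<le> y \<and> y < v} + card (upper_crossings A (V - {v}) f)))"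
    using insert by (intro sum.Sigma[symmetric]) (auto intro: finite_upper_maps)
  also have "\<dots> = (\<Sum>v\<in>?Vb. q ^ card {y \<in> V. b \<le> y \<and> y < v} *
                    (\<Sum>f\<in>upper_maps A (V - {v}). q ^ card (upper_crossings A (V - {v}) f)))"
    by (simp only: power_add sum_distrib_left)
  also have "\<dots> = (\<Sum>v\<in>?Vb. q ^ card {y \<in> ?Vb. y < v} * ?P)"
  proof (rule sum.cong[OF refl])
    fix v assume v: "v \<in> ?Vb"
    have "(\<Sum>f\<in>upper_maps A (V - {v}). q ^ card (upper_crossings A (V - {v}) f)) =
          (\<Prod>u\<in>A. qnum q (card {y \<in> V - {v}. u \<le> y} - card {z \<in> A. u < z}))"
      using insert by simp
    also have "\<dots> = ?P"
    proof (rule prod.cong[OF refl])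
      \<comment> \<open>Since \<open>u < b \<le> v\<close>, removing \<open>v\<close> costs one
        candidate, just as counting \<open>b\<close> among the greater starts does. Hence the inner
        sum does not depend on \<open>v\<close>.\<close>
      fix u assume u: "u \<in> A"
      have "{y \<in> V - {v}. u \<le> y} = {y \<in> V. u \<le> y} - {v}" by auto
      moreover have "v \<in> {y \<in> V. u \<le> y}" using u v insert(2) by force
      ultimately have 1: "card {y \<in> V - {v}. u \<le> y} = card {y \<in> V. u \<le> y} - 1"
        using insert.prems by (simp add: card_Diff_singleton)
      have "{z \<in> insert b A. u < z} = insert b {z \<in> A. u < z}"
        using insert(2) u by auto
      then have 2: "card {z \<in> insert b A. u < z} = Suc (card {z \<in> A. u < z})"
        using nb insert(1) by simp
      show "qnum q (card {y \<in> V - {v}. u \<le> y} - card {z \<in> A. u < z}) =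
            qnum q (card {v \<in> V. u \<le> v} - card {z \<in> insert b A. u < z})"
        unfolding 1 2 by simp
    qed
    finally show "q ^ card {y \<in> V. b \<le> y \<and> y < v} *
        (\<Sum>f\<in>upper_maps A (V - {v}). q ^ card (upper_crossings A (V - {v}) f)) =
        q ^ card {y \<in> ?Vb. y < v} * ?P"
      by (simp add: conj_ac)
  qed
  also have "\<dots> = qnum q (card ?Vb) * ?P"
    using sum_power_rank[of ?Vb q] insert.prems by (simp only: sum_distrib_right[symmetric]) simp
  \<comment> \<open>As \<open>b\<close> is maximal, nothing is subtracted in its own factor.\<close>
  also have "{z \<in> insert b A. b < z} = {}"
    using insert(2) by force
  then have "qnum q (card ?Vb) * ?P =
      (\<Prod>u\<in>insert b A. qnum q (card {v \<in> V. u \<le> v} - card {z \<in> insert b A. u < z}))"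
    by (simp only: prod.insert[OF insert(1) nb] card.empty diff_zero)
  finally show ?case .
qed

text \<open>The target \<open>b\<close> is the greatest, so each start \<open>y\<close> strictly
  between \<open>b\<close> and \<open>d\<close> gives a crossing \<open>(d, y)\<close>, whereas a
  pair \<open>(i, d)\<close> would need a target above \<open>b\<close>.\<close>

lemma card_lower_crossings_insert:
  assumes fin: "finite D" and b: "\<And>a. a \<in> A \<Longrightarrow> a < b"
    and d: "d \<in> D" "b < d" and g: "g \<in> lower_maps (D - {d}) A"
  shows "card (lower_crossings D (g(d := b))) =
           card {y \<in> D. b < y \<and> y < d} + card (lower_crossings (D - {d}) g)"
proof -
  have gb: "g i < b" if "i \<in> D" "i \<noteq> d" for i
    using g b that by (auto simp: lower_maps_def PiE_def Pi_def)
  have "lower_crossings D (g(d := b)) =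
        Pair d ` {y \<in> D. b < y \<and> y < d} \<union> lower_crossings (D - {d}) g"
    using gb d by (auto simp: lower_crossings_def) (metis less_asym)+
  moreover have "finite (lower_crossings (D - {d}) g)"
    by (rule finite_subset[of _ "D \<times> D"]) (auto simp: lower_crossings_def fin)
  moreover have "Pair d ` {y \<in> D. b < y \<and> y < d} \<inter> lower_crossings (D - {d}) g = {}"
    by (auto simp: lower_crossings_def)
  ultimately show ?thesis
    using fin by (simp add: card_Un_disjoint card_image inj_on_def)
qed

text \<open>Dual to the upper sum: here the targets are processed from the greatest down, and each
  picks its start. Equal cardinalities force \<open>D\<close> to be empty in the base case, where
  the product is \<open>1\<close>.\<close>

lemma sum_lower_maps:
  fixes q :: "'a::comm_semiring_1"
  assumes "finite T" "finite D" "card D = card T"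
  shows "(\<Sum>g\<in>lower_maps D T. q ^ card (lower_crossings D g)) =
         (\<Prod>t\<in>T. qnum q (card {d \<in> D. t < d} - card {z \<in> T. t < z}))"
  using assms
proof (induction T arbitrary: D rule: finite_linorder_max_induct)
  case empty
  then show ?case
    by (simp add: lower_maps_def lower_crossings_def bij_betw_def Collect_conv_if)
next
  case (insert b A)
  have nb: "b \<notin> A" using insert by blast
  let ?Db = "{d \<in> D. b < d}"
  let ?P = "\<Prod>t\<in>A. qnum q (card {d \<in> D. t < d} - card {z \<in> insert b A. t < z})"
  \<comment> \<open>\<open>down\<close> strips the greatest target together with its start, which
    \<open>inv_into\<close> recovers; \<open>up\<close> puts the pair back.\<close>
  have down: "inv_into D g b \<in> D" "g (inv_into D g b) = b" "b < inv_into D g b"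
    "restrict g (D - {inv_into D g b}) \<in> lower_maps (D - {inv_into D g b}) A"
    if g: "g \<in> lower_maps D (insert b A)" for g
  proof -
    have bij: "bij_betw g D (insert b A)" and less: "\<And>d. d \<in> D \<Longrightarrow> g d < d"
      using g by (auto simp: lower_maps_def)
    show 1: "inv_into D g b \<in> D" "g (inv_into D g b) = b"
      using bij by (auto simp: bij_betw_def intro: inv_into_into f_inv_into_f)
    with less[OF 1(1)] show "b < inv_into D g b" by simp
    have "bij_betw g (D - {inv_into D g b}) (insert b A - {g (inv_into D g b)})"
      using bij 1 by (intro bij_betw_DiffI) auto
    then have "bij_betw g (D - {inv_into D g b}) A"
      using nb 1 by simp
    then show "restrict g (D - {inv_into D g b}) \<in> lower_maps (D - {inv_into D g b}) A"
      using less by (auto simp: lower_maps_def bij_betw_def inj_on_def)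
  qed
  have up: "g(d := b) \<in> lower_maps D (insert b A)" "inv_into D (g(d := b)) b = d"
    if d: "d \<in> ?Db" and g: "g \<in> lower_maps (D - {d}) A" for d g
  proof -
    have bij: "bij_betw g (D - {d}) A" and less: "\<And>i. i \<in> D - {d} \<Longrightarrow> g i < i"
      using g by (auto simp: lower_maps_def)
    have "inj_on (g(d := b)) D"
      using bij nb by (auto simp: bij_betw_def inj_on_def)
    moreover have "(g(d := b)) ` D = insert b A"
      using bij d by (auto simp: bij_betw_def)
    ultimately have bij': "bij_betw (g(d := b)) D (insert b A)"
      by (simp add: bij_betw_def)
    show "inv_into D (g(d := b)) b = d"
      using inv_into_f_f[of "g(d := b)" D d] bij' d by (simp add: bij_betw_def)
    have "g(d := b) \<in> extensional D"
      using g d by (auto simp: lower_maps_def PiE_def extensional_def)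
    then show "g(d := b) \<in> lower_maps D (insert b A)"
      using bij' less d by (auto simp: lower_maps_def PiE_def Pi_def bij_betw_def)
  qed
  have "(\<Sum>g\<in>lower_maps D (insert b A). q ^ card (lower_crossings D g)) =
        (\<Sum>(d, g)\<in>(SIGMA d:?Db. lower_maps (D - {d}) A).
           q ^ (card {y \<in> D. b < y \<and> y < d} + card (lower_crossings (D - {d}) g)))"
  proof (rule sum.reindex_bij_witness[where i = "\<lambda>(d, g). g(d := b)"
        and j = "\<lambda>g. (inv_into D g b, restrict g (D - {inv_into D g b}))"], goal_cases)
    case (1 g)
    then show ?case using down[OF 1]
      by (auto simp: lower_maps_def fun_eq_iff restrict_def PiE_def extensional_def)
  next
    case (2 g)
    then show ?case using down[OF 2] by auto
  next
    case (3 p)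
    then show ?case using up
      by (auto simp: lower_maps_def fun_eq_iff restrict_def PiE_def extensional_def)
  next
    case (4 p)
    then show ?case using up by auto
  next
    case (5 g)
    have eq: "g = (restrict g (D - {inv_into D g b}))(inv_into D g b := b)"
      using 5 down[OF 5] by (auto simp: lower_maps_def fun_eq_iff restrict_def PiE_def extensional_def)
    from card_lower_crossings_insert[OF insert.prems(1) insert(2)[rule_format] down(1)[OF 5] down(3)[OF 5] down(4)[OF 5]]
    show ?case using eq by simp
  qed
  also have "\<dots> = (\<Sum>d\<in>?Db. \<Sum>g\<in>lower_maps (D - {d}) A.
           q ^ (card {y \<in> D. b < y \<and> y < d} + card (lower_crossings (D - {d}) g)))"
    using insert by (intro sum.Sigma[symmetric]) (auto intro: finite_lower_maps)
  also have "\<dots> = (\<Sum>d\<in>?Db. q ^ card {y \<in> D. b < y \<and> y < d} *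
                    (\<Sum>g\<in>lower_maps (D - {d}) A. q ^ card (lower_crossings (D - {d}) g)))"
    by (simp only: power_add sum_distrib_left)
  also have "\<dots> = (\<Sum>d\<in>?Db. q ^ card {y \<in> ?Db. y < d} * ?P)"
  proof (rule sum.cong[OF refl])
    fix d assume d: "d \<in> ?Db"
    have "(\<Sum>g\<in>lower_maps (D - {d}) A. q ^ card (lower_crossings (D - {d}) g)) =
          (\<Prod>t\<in>A. qnum q (card {y \<in> D - {d}. t < y} - card {z \<in> A. t < z}))"
      using insert d nb by (simp add: card_Diff_singleton)
    also have "\<dots> = ?P"
    proof (rule prod.cong[OF refl])
      fix t assume t: "t \<in> A"
      have "{y \<in> D - {d}. t < y} = {y \<in> D. t < y} - {d}" by auto
      moreover have "d \<in> {y \<in> D. t < y}" using t d insert(2) by force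
      ultimately have 1: "card {y \<in> D - {d}. t < y} = card {y \<in> D. t < y} - 1"
        using insert.prems by (simp add: card_Diff_singleton)
      have "{z \<in> insert b A. t < z} = insert b {z \<in> A. t < z}"
        using insert(2) t by auto
      then have 2: "card {z \<in> insert b A. t < z} = Suc (card {z \<in> A. t < z})"
        using nb insert(1) by simp
      show "qnum q (card {y \<in> D - {d}. t < y} - card {z \<in> A. t < z}) =
            qnum q (card {d \<in> D. t < d} - card {z \<in> insert b A. t < z})"
        unfolding 1 2 by simp
    qed
    finally show "q ^ card {y \<in> D. b < y \<and> y < d} *
        (\<Sum>g\<in>lower_maps (D - {d}) A. q ^ card (lower_crossings (D - {d}) g)) =
        q ^ card {y \<in> ?Db. y < d} * ?P"
      by (simp add: conj_ac)
  qed
  also have "\<dots> = qnum q (card ?Db) * ?P"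
    using sum_power_rank[of ?Db q] insert.prems by (simp only: sum_distrib_right[symmetric]) simp
  also have "{z \<in> insert b A. b < z} = {}"
    using insert(2) by force
  then have "qnum q (card ?Db) * ?P =
      (\<Prod>t\<in>insert b A. qnum q (card {d \<in> D. t < d} - card {z \<in> insert b A. t < z}))"
    by (simp only: prod.insert[OF insert(1) nb] card.empty diff_zero)
  finally show ?case .
qed

subsection \<open>Signed permutations with prescribed weak exceedances\<close>

definition exc_set :: "nat \<Rightarrow> (int \<Rightarrow> int) \<Rightarrow> int set" where
  "exc_set n \<pi> = {i \<in> {1..int n}. i \<le> \<pi> i}"

text \<open>The set of \<open>v > 0\<close> with \<open>\<pi>\<^sup>-\<^sup>1 v \<le> v\<close>, where \<open>\<pi>\<^sup>-\<^sup>1 v\<close> may be negative.\<close>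

definition val_set :: "nat \<Rightarrow> (int \<Rightarrow> int) \<Rightarrow> int set" where
  "val_set n \<pi> = {1..int n} - \<pi> ` ({1..int n} - exc_set n \<pi>)"

definition odd_ext :: "nat \<Rightarrow> (int \<Rightarrow> int) \<Rightarrow> int \<Rightarrow> int" where
  "odd_ext n w i = (if i \<in> {1..int n} then w i else if - i \<in> {1..int n} then - w (- i) else i)"

text \<open>Reduces membership to the word: the absolute values of the letters must cover
  \<open>1\<close> to \<open>n\<close>. Surjectivity suffices because the set is finite.\<close>

lemma signed_perms_iff:
  "\<pi> \<in> signed_perms n \<longleftrightarrow>
     (\<forall>i. \<pi> (- i) = - \<pi> i) \<and> (\<forall>i. \<bar>i\<bar> \<notin> {1..int n} \<longrightarrow> \<pi> i = i) \<and>
     (\<lambda>i. \<bar>\<pi> i\<bar>) ` {1..int n} = {1..int n}"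
    (is "?L \<longleftrightarrow> ?odd \<and> ?id \<and> ?surj")
proof -
  define S where "S = {- int n..int n} - {0}"
  have S: "i \<in> S \<longleftrightarrow> \<bar>i\<bar> \<in> {1..int n}" for i by (auto simp: S_def)
  have L: "?L \<longleftrightarrow> \<pi> permutes S \<and> ?odd"
    by (simp add: signed_perms_def S_def)
  show ?thesis
  proof (intro iffI conjI)
    assume ?L
    then have perm: "\<pi> permutes S" and odd: ?odd
      using L by blast+
    show ?odd by (rule odd)
    show ?id
      using perm S permutes_not_in by metis
    have im: "\<pi> ` S = S"
      using perm by (rule permutes_image)
    show ?surj
    proof (intro equalityI subsetI)
      fix v assume "v \<in> (\<lambda>i. \<bar>\<pi> i\<bar>) ` {1..int n}"
      then obtain i where i: "i \<in> {1..int n}" "v = \<bar>\<pi> i\<bar>" by blast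
      then have "i \<in> S" by (simp add: S)
      with im have "\<pi> i \<in> S" by blast
      with i(2) show "v \<in> {1..int n}" by (simp add: S)
    next
      fix v assume v: "v \<in> {1..int n}"
      then have "v \<in> \<pi> ` S" unfolding im by (simp add: S)
      then obtain s where s: "s \<in> S" "v = \<pi> s" by blast
      then have "v = \<bar>\<pi> \<bar>s\<bar>\<bar>"
        using odd v by (cases "s \<ge> 0") auto
      moreover have "\<bar>s\<bar> \<in> {1..int n}" using s(1) S by blast
      ultimately show "v \<in> (\<lambda>i. \<bar>\<pi> i\<bar>) ` {1..int n}" by blast
    qed
  next
    assume R: "?odd \<and> ?id \<and> ?surj"
    then have odd: ?odd and id: ?id and surj: ?surj by blast+
    have abs: "\<bar>\<pi> i\<bar> = \<bar>\<pi> \<bar>i\<bar>\<bar>" for i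
      using odd by (cases "i \<ge> 0") simp_all
    have im: "\<pi> ` S = S"
    proof (intro equalityI subsetI)
      fix v assume "v \<in> \<pi> ` S"
      then obtain i where i: "\<bar>i\<bar> \<in> {1..int n}" "v = \<pi> i" using S by blast
      then have "\<bar>v\<bar> \<in> (\<lambda>i. \<bar>\<pi> i\<bar>) ` {1..int n}" using abs[of i] by blast
      then show "v \<in> S" unfolding surj S .
    next
      fix v assume "v \<in> S"
      then have "\<bar>v\<bar> \<in> (\<lambda>i. \<bar>\<pi> i\<bar>) ` {1..int n}" unfolding surj S .
      then obtain i where i: "i \<in> {1..int n}" "\<bar>v\<bar> = \<bar>\<pi> i\<bar>" by blast
      then have "v = \<pi> i \<or> v = - \<pi> i" by linarith
      then have "v = \<pi> i \<or> v = \<pi> (- i)" using odd by simp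
      moreover have "i \<in> S" "- i \<in> S" using i(1) by (simp_all add: S)
      ultimately show "v \<in> \<pi> ` S" by blast
    qed
    moreover have "inj_on \<pi> S"
      by (rule finite_surj_inj) (simp_all only: im order_refl, simp add: S_def)
    ultimately have bij: "bij_betw \<pi> S S"
      by (simp add: bij_betw_def)
    have "\<pi> permutes S"
    proof (rule bij_imp_permutes[OF bij])
      fix i assume "i \<notin> S"
      with S id show "\<pi> i = i" by blast
    qed
    with odd L show ?L by blast
  qed
qed

section \<open>Letters, statistics and crossings of one signed permutation\<close>

context
  fixes n :: nat and \<pi> :: "int \<Rightarrow> int"
  assumes \<pi>: "\<pi> \<in> signed_perms n"
begin

lemma signed_perm_odd: "\<pi> (- i) = - \<pi> i"
  and signed_perm_id: "\<bar>i\<bar> \<notin> {1..int n} \<Longrightarrow> \<pi> i = i"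
  and signed_perm_abs_image: "(\<lambda>i. \<bar>\<pi> i\<bar>) ` {1..int n} = {1..int n}"
  using signed_perms_iff[THEN iffD1, OF \<pi>] by blast+

lemma signed_perm_abs_in: "i \<in> {1..int n} \<Longrightarrow> \<bar>\<pi> i\<bar> \<in> {1..int n}"
  by (subst signed_perm_abs_image[symmetric]) (rule imageI)

lemma signed_perm_abs_inj: "inj_on (\<lambda>i. \<bar>\<pi> i\<bar>) {1..int n}"
  by (rule finite_surj_inj) (simp_all only: signed_perm_abs_image order_refl, simp)

lemma signed_perm_abs_eqD:
  "i \<in> {1..int n} \<Longrightarrow> j \<in> {1..int n} \<Longrightarrow> \<bar>\<pi> i\<bar> = \<bar>\<pi> j\<bar> \<Longrightarrow> i = j"
  by (rule inj_onD[OF signed_perm_abs_inj])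

lemma signed_perm_abs_obtain:
  assumes "v \<in> {1..int n}"
  obtains i where "i \<in> {1..int n}" "\<bar>\<pi> i\<bar> = v"
proof -
  from assms have "v \<in> (\<lambda>i. \<bar>\<pi> i\<bar>) ` {1..int n}"
    by (simp only: signed_perm_abs_image)
  then show ?thesis
    using that by (elim imageE) simp
qed

lemma signed_perm_nonzero: "i \<in> {1..int n} \<Longrightarrow> \<pi> i \<noteq> 0"
  using signed_perm_abs_in[of i] by auto

lemma odd_ext_signed_perm:
  assumes "\<And>i. i \<in> {1..int n} \<Longrightarrow> w i = \<pi> i"
  shows "odd_ext n w = \<pi>"
proof
  fix i
  consider "i \<in> {1..int n}" | "- i \<in> {1..int n}" "i \<notin> {1..int n}"
    | "\<bar>i\<bar> \<notin> {1..int n}" "i \<notin> {1..int n}" "- i \<notin> {1..int n}"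
    by fastforce
  then show "odd_ext n w i = \<pi> i"
  proof cases
    case 1
    then show ?thesis by (simp only: odd_ext_def assms if_True)
  next
    case 2
    then show ?thesis by (simp only: odd_ext_def assms if_True if_False signed_perm_odd minus_minus)
  next
    case 3
    then show ?thesis by (simp only: odd_ext_def if_False signed_perm_id[OF 3(1)])
  qed
qed

text \<open>The positions split into weak exceedances, other positive letters \<open>P\<close>, and
  negative letters. Only \<open>P\<close> removes values from \<open>{1..int n}\<close>, so the size
  is \<open>n - card P\<close>, which counts the other two classes.\<close>

lemma card_val_set: "card (val_set n \<pi>) = wex n \<pi> + neg n \<pi>"
proof -
  let ?I = "{1..int n}"
  define U where "U = exc_set n \<pi>"
  define P where "P = {i \<in> ?I - U. \<pi> i > 0}"
  define N where "N = {i \<in> ?I. \<pi> i < 0}"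
  have sub: "U \<subseteq> ?I" "P \<subseteq> ?I" "N \<subseteq> ?I" and disj: "U \<inter> P = {}" "(U \<union> P) \<inter> N = {}"
    by (auto simp: U_def P_def N_def exc_set_def)
  then have fin: "finite U" "finite P" "finite N"
    using finite_subset by blast+
  have PI: "\<pi> ` P \<subseteq> ?I"
  proof
    fix v assume "v \<in> \<pi> ` P"
    then obtain i where i: "i \<in> ?I" "v = \<pi> i" "\<pi> i > 0" by (auto simp: P_def)
    with signed_perm_abs_in[OF i(1)] show "v \<in> ?I" by simp
  qed
  have "inj_on \<pi> P"
  proof (rule inj_onI)
    fix i j assume "i \<in> P" "j \<in> P" "\<pi> i = \<pi> j"
    then show "i = j" using sub by (auto intro!: signed_perm_abs_eqD[of i j])
  qed
  then have cardP: "card (\<pi> ` P) = card P"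
    by (rule card_image)
  have "val_set n \<pi> = ?I - \<pi> ` P"
    unfolding val_set_def P_def U_def by force
  then have "card (val_set n \<pi>) = n - card P" "card P \<le> n"
    using PI fin(2) card_mono[of ?I "\<pi> ` P"] by (simp_all add: card_Diff_subset cardP)
  moreover have "U \<union> P \<union> N = ?I"
  proof (intro equalityI subsetI)
    fix i assume "i \<in> ?I"
    with signed_perm_nonzero[of i] have "i \<in> ?I" "\<pi> i < 0 \<or> \<pi> i > 0"
      by auto
    then show "i \<in> U \<union> P \<union> N"
      unfolding P_def N_def by blast
  qed (use sub in blast)
  then have "card U + card P + card N = n"
    using card_Un_disjoint[OF fin(1,2) disj(1)]
      card_Un_disjoint[OF finite_UnI[OF fin(1,2)] fin(3) disj(2)] by simp
  moreover have "card U = wex n \<pi>" "card N = neg n \<pi>"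
    by (simp_all add: U_def N_def wex_def neg_def exc_set_def)
  ultimately show ?thesis
    by linarith
qed

text \<open>In the first two kinds \<open>j\<close> is a weak exceedance, and
  \<open>\<bar>\<pi> i\<bar>\<close> determines \<open>i\<close>, so
  \<open>(j, \<bar>\<pi> i\<bar>)\<close> encodes the pair. In the third kind neither position is a
  weak exceedance.\<close>

lemma cro_eq:
  "cro n \<pi> = card (upper_crossings (exc_set n \<pi>) (val_set n \<pi>) \<pi>) +
             card (lower_crossings ({1..int n} - exc_set n \<pi>) \<pi>)"
proof -
  let ?I = "{1..int n}" and ?U = "exc_set n \<pi>" and ?V = "val_set n \<pi>"
  let ?A = "{(i, j). i \<in> ?I \<and> j \<in> ?I \<and> ((i < j \<and> j \<le> \<pi> i \<and> \<pi> i < \<pi> j) \<or>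
         (- i < j \<and> j \<le> - \<pi> i \<and> - \<pi> i < \<pi> j))}"
  let ?L = "lower_crossings (?I - ?U) \<pi>"
  let ?h = "\<lambda>(i, j). (j, \<bar>\<pi> i\<bar>)"
  have fin: "finite ?A" "finite ?L"
    by (rule finite_subset[of _ "?I \<times> ?I"]; auto simp: lower_crossings_def)+
  have "crossings n \<pi> = ?A \<union> ?L"
    unfolding crossings_def lower_crossings_def exc_set_def by auto
  moreover have "?A \<inter> ?L = {}"
    by (auto simp: lower_crossings_def exc_set_def)
  ultimately have "cro n \<pi> = card ?A + card ?L"
    using fin by (simp add: cro_def card_Un_disjoint)
  also have "inj_on ?h ?A"
    using signed_perm_abs_eqD by (auto simp: inj_on_def)
  then have "card ?A = card (?h ` ?A)"
    by (simp add: card_image)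
  also have "?h ` ?A = upper_crossings ?U ?V \<pi>"
  proof (intro equalityI subsetI)
    fix p assume "p \<in> ?h ` ?A"
    then obtain i j where p: "p = (j, \<bar>\<pi> i\<bar>)" and ij: "i \<in> ?I" "j \<in> ?I"
      and cr: "(i < j \<and> j \<le> \<pi> i \<and> \<pi> i < \<pi> j) \<or> (j \<le> - \<pi> i \<and> - \<pi> i < \<pi> j)"
      by auto
    have j: "j \<in> ?U" "j \<le> \<bar>\<pi> i\<bar>" "\<bar>\<pi> i\<bar> < \<pi> j"
      using ij cr by (auto simp: exc_set_def)
    \<comment> \<open>Equality would give \<open>d = i\<close> with a positive letter, hence a
      crossing of the first kind and \<open>i < \<pi> i\<close>.\<close>
    have "\<bar>\<pi> i\<bar> \<noteq> \<pi> d" if d: "d \<in> ?I - ?U" for d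
    proof
      assume eq: "\<bar>\<pi> i\<bar> = \<pi> d"
      with signed_perm_abs_eqD[of i d] ij d have "i = d" by auto
      with d eq cr ij show False by (auto simp: exc_set_def)
    qed
    then have "\<bar>\<pi> i\<bar> \<in> ?V"
      using signed_perm_abs_in[OF ij(1)] unfolding val_set_def by blast
    moreover have "z < j" if "z \<in> ?U" "\<pi> z = \<bar>\<pi> i\<bar>" for z
    proof -
      have "z = i" using signed_perm_abs_eqD[of z i] that ij by (auto simp: exc_set_def)
      with that cr ij show ?thesis by auto
    qed
    ultimately show "p \<in> upper_crossings ?U ?V \<pi>"
      using p j by (auto simp: upper_crossings_def)
  next
    fix p assume p: "p \<in> upper_crossings ?U ?V \<pi>"
    then obtain j v where jv: "p = (j, v)" "j \<in> ?U" "v \<in> ?V" "j \<le> v" "v < \<pi> j"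
      and cr: "\<And>z. z \<in> ?U \<Longrightarrow> \<pi> z = v \<Longrightarrow> z < j"
      by (auto simp: upper_crossings_def)
    obtain i where i: "i \<in> ?I" "\<bar>\<pi> i\<bar> = v"
      using jv signed_perm_abs_obtain[of v] by (auto simp: val_set_def)
    \<comment> \<open>The sign of the letter decides the kind. If it is positive, membership of
      \<open>v\<close> in the value set makes \<open>i\<close> a weak exceedance, and the last
      clause of \<open>upper_crossings\<close> yields \<open>i < j\<close>.\<close>
    have "(i, j) \<in> ?A"
    proof (cases "\<pi> i > 0")
      case True
      then have v: "v = \<pi> i" using i by simp
      then have "i \<in> ?U" using jv(3) i by (auto simp: val_set_def)
      with cr v jv show ?thesis by (auto simp: exc_set_def)
    next
      case False
      then have "v = - \<pi> i" using i by simp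
      with jv i show ?thesis by (auto simp: exc_set_def)
    qed
    then show "p \<in> ?h ` ?A"
      using jv i by (intro image_eqI[of _ _ "(i, j)"]) auto
  qed
  finally show ?thesis .
qed

end

section \<open>The crossing sum for fixed sets, through pairs of matchings\<close>

lemma upper_crossings_restrict: "upper_crossings U V (restrict f U) = upper_crossings U V f"
  by (auto simp: upper_crossings_def)

lemma lower_crossings_restrict: "lower_crossings D (restrict g D) = lower_crossings D g"
  by (auto simp: lower_crossings_def)

text \<open>The targets depend on \<open>f\<close>, but the sum does not: negative targets never lie
  above a positive one, and they contribute only through their number, as a
  \<open>q\<close>-factorial. This independence lets the full sum factor.\<close>

lemma sum_lower_maps_signed:
  fixes q :: "'a::comm_semiring_1" and n :: nat
  defines "I \<equiv> {1..int n}"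
  assumes UV: "U \<subseteq> I" "V \<subseteq> I" and f: "f \<in> upper_maps U V"
  shows "(\<Sum>g\<in>lower_maps (I - U) ((I - V) \<union> uminus ` (V - f ` U)).
            q ^ card (lower_crossings (I - U) g)) =
         (\<Prod>c\<in>I - V. qnum q (card {d \<in> I - U. c < d} - card {z \<in> I - V. c < z})) *
         (\<Prod>r<card V - card U. qnum q (card V - card U - r))"
proof -
  let ?X = "V - f ` U"
  let ?T = "(I - V) \<union> uminus ` ?X"
  have fin: "finite I" "finite U" "finite V"
    using UV finite_subset by (auto simp: I_def)
  have fUV: "f ` U \<subseteq> V" and card_fU: "card (f ` U) = card U"
    using f by (auto simp: upper_maps_def card_image)
  then have le: "card U \<le> card V" "card V \<le> card I"
    using fin UV card_mono[of V "f ` U"] by (auto intro: card_mono)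
  have disj: "(I - V) \<inter> uminus ` ?X = {}"
    using UV by (auto simp: I_def)
  have cardX: "card ?X = card V - card U"
    using fUV fin card_fU by (simp add: card_Diff_subset)
  have cardC: "card (I - V) = card I - card V" and cardD: "card (I - U) = card I - card U"
    using fin UV by (simp_all add: card_Diff_subset)
  have cardT: "card (I - U) = card ?T"
    using disj fin le cardX cardC cardD by (simp add: card_Un_disjoint card_image)
  let ?b = "\<lambda>t. qnum q (card {d \<in> I - U. t < d} - card {z \<in> ?T. t < z})"
  have "(\<Prod>t\<in>?T. ?b t) = (\<Prod>t\<in>I - V. ?b t) * (\<Prod>t\<in>uminus ` ?X. ?b t)"
    using fin disj by (intro prod.union_disjoint) auto
  also have "(\<Prod>t\<in>I - V. ?b t) =
      (\<Prod>c\<in>I - V. qnum q (card {d \<in> I - U. c < d} - card {z \<in> I - V. c < z}))"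
  proof (rule prod.cong[OF refl])
    fix c assume c: "c \<in> I - V"
    have "{z \<in> ?T. c < z} = {z \<in> I - V. c < z}"
      using c UV by (force simp: I_def)
    then show "?b c = qnum q (card {d \<in> I - U. c < d} - card {z \<in> I - V. c < z})"
      by simp
  qed
  also have "(\<Prod>t\<in>uminus ` ?X. ?b t) = (\<Prod>x\<in>?X. ?b (- x))"
    by (subst prod.reindex) auto
  also have "\<dots> = (\<Prod>x\<in>?X. qnum q (card V - card U - card {y \<in> ?X. y < x}))"
  proof (rule prod.cong[OF refl])
    fix x assume x: "x \<in> ?X"
    then have "x \<ge> 1" using UV by (auto simp: I_def)
    \<comment> \<open>Every position exceeds \<open>- x\<close>. Above \<open>- x\<close> lie all
      positive targets and the \<open>- y\<close> with \<open>y < x\<close>, so the factor depends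
      only on the rank of \<open>x\<close>.\<close>
    then have "{d \<in> I - U. - x < d} = I - U"
      by (auto simp: I_def)
    moreover have "{z \<in> ?T. - x < z} = (I - V) \<union> uminus ` {y \<in> ?X. y < x}"
      using \<open>x \<ge> 1\<close> by (auto simp: I_def)
    moreover have "card \<dots> = card (I - V) + card {y \<in> ?X. y < x}"
      using fin disj by (subst card_Un_disjoint) (auto simp: card_image)
    ultimately show "?b (- x) = qnum q (card V - card U - card {y \<in> ?X. y < x})"
      using le cardC cardD by simp
  qed
  also have "\<dots> = (\<Prod>r<card ?X. qnum q (card V - card U - r))"
    using prod.reindex_bij_betw[OF bij_betw_rank[of ?X],
        where g = "\<lambda>r. qnum q (card V - card U - r)"] fin by blast
  finally show ?thesis
    using sum_lower_maps[OF _ _ cardT, of q] fin cardX by simp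
qed

lemma restrict_upper_maps:
  assumes \<pi>: "\<pi> \<in> signed_perms n"
  shows "restrict \<pi> (exc_set n \<pi>) \<in> upper_maps (exc_set n \<pi>) (val_set n \<pi>)"
proof -
  have "\<pi> u \<in> val_set n \<pi>" if u: "u \<in> exc_set n \<pi>" for u
  proof -
    have uI: "u \<in> {1..int n}" "0 < \<pi> u" using u by (auto simp: exc_set_def)
    have "\<pi> u \<noteq> \<pi> d" if "d \<in> {1..int n} - exc_set n \<pi>" for d
      using signed_perm_abs_eqD[OF \<pi>, of u d] u uI that by auto
    moreover have "\<pi> u \<in> {1..int n}"
      using signed_perm_abs_in[OF \<pi> uI(1)] uI(2) by simp
    ultimately show ?thesis
      unfolding val_set_def by blast
  qed
  moreover have "inj_on \<pi> (exc_set n \<pi>)"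
    by (rule inj_onI, rule signed_perm_abs_eqD[OF \<pi>]) (auto simp: exc_set_def)
  ultimately show ?thesis
    by (auto simp: upper_maps_def exc_set_def)
qed

lemma restrict_lower_maps:
  fixes n :: nat
  defines "I \<equiv> {1..int n}"
  assumes \<pi>: "\<pi> \<in> signed_perms n"
  shows "restrict \<pi> (I - exc_set n \<pi>) \<in> lower_maps (I - exc_set n \<pi>)
           ((I - val_set n \<pi>) \<union> uminus ` (val_set n \<pi> - \<pi> ` exc_set n \<pi>))"
proof -
  define U where "U = exc_set n \<pi>"
  define V where "V = val_set n \<pi>"
  have V: "V = I - \<pi> ` (I - U)" and UI: "U \<subseteq> I"
    by (auto simp: V_def U_def I_def val_set_def exc_set_def)
  note eqD = signed_perm_abs_eqD[OF \<pi>, folded I_def]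
  have "inj_on \<pi> (I - U)"
    by (rule inj_onI, rule eqD) auto
  moreover have "\<pi> ` (I - U) = (I - V) \<union> uminus ` (V - \<pi> ` U)"
  proof (intro equalityI subsetI)
    fix t assume "t \<in> \<pi> ` (I - U)"
    then obtain d where d: "d \<in> I" "d \<notin> U" "t = \<pi> d" by blast
    have tI: "\<bar>t\<bar> \<in> I"
      using signed_perm_abs_in[OF \<pi>] d by (simp add: I_def)
    show "t \<in> (I - V) \<union> uminus ` (V - \<pi> ` U)"
    proof (cases "t > 0")
      case True
      with tI d V show ?thesis by auto
    next
      case False
      with tI have neg: "t < 0" by (auto simp: I_def)
      have "- t \<noteq> \<pi> i" if i: "i \<in> I" for i
      proof
        assume eq: "- t = \<pi> i"
        with d have "d = i" by (intro eqD[OF d(1) i]) simp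
        with eq d neg show False by simp
      qed
      then have "- t \<in> V - \<pi> ` U"
        using tI neg V UI by auto
      then show ?thesis by force
    qed
  next
    fix t assume "t \<in> (I - V) \<union> uminus ` (V - \<pi> ` U)"
    then consider "t \<in> I - V" | v where "t = - v" "v \<in> V" "v \<notin> \<pi> ` U"
      by blast
    then show "t \<in> \<pi> ` (I - U)"
    proof cases
      case 1
      then show ?thesis using V by blast
    next
      case 2
      then have "v \<in> I" using V by blast
      then obtain i where i: "i \<in> I" "\<bar>\<pi> i\<bar> = v"
        using signed_perm_abs_obtain[OF \<pi>, of v] unfolding I_def by blast
      have "\<pi> i \<noteq> v"
        using 2 i V by blast
      with i have "t = \<pi> i" using 2 by auto
      moreover have "i \<notin> U"
        using i \<open>\<pi> i \<noteq> v\<close> by (auto simp: U_def exc_set_def)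
      ultimately show ?thesis using i by blast
    qed
  qed
  moreover have "\<pi> d < d" if "d \<in> I - U" for d
    using that by (auto simp: U_def exc_set_def I_def)
  ultimately show ?thesis
    unfolding U_def[symmetric] V_def[symmetric]
    by (auto simp: lower_maps_def bij_betw_def inj_on_def)
qed

text \<open>The converse of the two restrictions: any compatible pair glues to a signed permutation,
  because \<open>f\<close> U\<open>,\<close>I - V\<open>and\<close>V - f \<open>U\<close> together
  make up \<open>I\<close>.\<close>

lemma odd_ext_maps:
  fixes n :: nat
  defines "I \<equiv> {1..int n}"
  assumes UV: "U \<subseteq> I" "V \<subseteq> I" and f: "f \<in> upper_maps U V"
    and g: "g \<in> lower_maps (I - U) ((I - V) \<union> uminus ` (V - f ` U))"
  defines "\<pi> \<equiv> odd_ext n (\<lambda>i. if i \<in> U then f i else g i)"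
  shows "\<pi> \<in> signed_perms n" and "exc_set n \<pi> = U" and "val_set n \<pi> = V"
    and "restrict \<pi> U = f" and "restrict \<pi> (I - U) = g"
proof -
  have f': "f ` U \<subseteq> V" "f \<in> extensional U" "\<And>u. u \<in> U \<Longrightarrow> u \<le> f u"
    using f by (auto simp: upper_maps_def PiE_def)
  have g': "g ` (I - U) = (I - V) \<union> uminus ` (V - f ` U)" "g \<in> extensional (I - U)"
      "\<And>d. d \<in> I - U \<Longrightarrow> g d < d"
    using g by (auto simp: lower_maps_def PiE_def bij_betw_def)
  have \<pi>U: "\<pi> i = f i" if "i \<in> U" for i
    using that UV by (auto simp: \<pi>_def odd_ext_def I_def)
  have \<pi>D: "\<pi> i = g i" if "i \<in> I - U" for i
    using that UV by (auto simp: \<pi>_def odd_ext_def I_def)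
  show "restrict \<pi> U = f"
    using f'(2) \<pi>U by (auto simp: fun_eq_iff extensional_def)
  show "restrict \<pi> (I - U) = g"
    using g'(2) \<pi>D by (auto simp: fun_eq_iff extensional_def)
  show exc: "exc_set n \<pi> = U"
    using f'(3) g'(3) \<pi>U \<pi>D UV unfolding exc_set_def I_def[symmetric] by force
  have \<pi>imD: "\<pi> ` (I - U) = (I - V) \<union> uminus ` (V - f ` U)"
    using \<pi>D g'(1) by (metis image_cong)
  have \<pi>imU: "\<pi> ` U = f ` U"
    using \<pi>U by (rule image_cong[OF refl])
  have "- v \<notin> I" if "v \<in> V" for v
    using that UV(2) by (force simp: I_def)
  then show "val_set n \<pi> = V"
    unfolding val_set_def exc I_def[symmetric] \<pi>imD using UV by blast
  have "I = U \<union> (I - U)"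
    using UV by blast
  then have "(\<lambda>i. \<bar>\<pi> i\<bar>) ` I = abs ` (\<pi> ` U \<union> \<pi> ` (I - U))"
    by (metis image_Un image_image)
  also have "\<dots> = abs ` (f ` U) \<union> abs ` (I - V) \<union> (\<lambda>v. \<bar>- v\<bar>) ` (V - f ` U)"
    unfolding \<pi>imU \<pi>imD image_Un image_image Un_assoc ..
  also have "\<dots> = f ` U \<union> (I - V) \<union> (V - f ` U)"
  proof -
    have "abs ` A = A" "(\<lambda>v. \<bar>- v\<bar>) ` A = A" if "A \<subseteq> I" for A
      using that by (force simp: I_def)+
    moreover have "f ` U \<subseteq> I" "I - V \<subseteq> I" "V - f ` U \<subseteq> I"
      using f'(1) UV by blast+
    ultimately show ?thesis by metis
  qed
  also have "\<dots> = I"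
    using f'(1) UV by blast
  finally have "(\<lambda>i. \<bar>\<pi> i\<bar>) ` {1..int n} = {1..int n}"
    by (simp only: I_def)
  then show "\<pi> \<in> signed_perms n"
    unfolding signed_perms_iff by (auto simp: \<pi>_def odd_ext_def)
qed

lemma sum_cro_fixed_sets:
  fixes q :: "'a::comm_semiring_1" and n :: nat
  defines "I \<equiv> {1..int n}"
  assumes UV: "U \<subseteq> I" "V \<subseteq> I"
  shows "(\<Sum>\<pi> | \<pi> \<in> signed_perms n \<and> exc_set n \<pi> = U \<and> val_set n \<pi> = V. q ^ cro n \<pi>) =
         (\<Prod>u\<in>U. qnum q (card {v \<in> V. u \<le> v} - card {z \<in> U. u < z})) *
         (\<Prod>c\<in>I - V. qnum q (card {d \<in> I - U. c < d} - card {z \<in> I - V. c < z})) *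
         (\<Prod>r<card V - card U. qnum q (card V - card U - r))"
proof -
  define T where "T f = (I - V) \<union> uminus ` (V - f ` U)" for f :: "int \<Rightarrow> int"
  have fin: "finite I" "finite U" "finite V"
    using UV finite_subset by (auto simp: I_def)
  have "(\<Sum>\<pi> | \<pi> \<in> signed_perms n \<and> exc_set n \<pi> = U \<and> val_set n \<pi> = V. q ^ cro n \<pi>) =
        (\<Sum>(f, g)\<in>(SIGMA f:upper_maps U V. lower_maps (I - U) (T f)).
           q ^ (card (upper_crossings U V f) + card (lower_crossings (I - U) g)))"
  proof (rule sum.reindex_bij_witness[where
        i = "\<lambda>(f, g). odd_ext n (\<lambda>i. if i \<in> U then f i else g i)"
        and j = "\<lambda>\<pi>. (restrict \<pi> U, restrict \<pi> (I - U))"], goal_cases)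
    case (1 \<pi>)
    then show ?case
      by (auto simp: I_def intro!: odd_ext_signed_perm)
  next
    case (2 \<pi>)
    then show ?case
      using restrict_upper_maps[of \<pi> n] restrict_lower_maps[of \<pi> n] by (auto simp: T_def I_def)
  next
    case (3 p)
    then show ?case
      using odd_ext_maps[OF UV[unfolded I_def]] by (auto simp: T_def I_def)
  next
    case (4 p)
    then show ?case
      using odd_ext_maps[OF UV[unfolded I_def]] by (auto simp: T_def I_def)
  next
    case (5 \<pi>)
    then show ?case
      using cro_eq[of \<pi> n] by (auto simp: upper_crossings_restrict lower_crossings_restrict I_def)
  qed
  also have "\<dots> = (\<Sum>f\<in>upper_maps U V. \<Sum>g\<in>lower_maps (I - U) (T f).
           q ^ (card (upper_crossings U V f) + card (lower_crossings (I - U) g)))"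
    using fin by (intro sum.Sigma[symmetric])
      (auto intro!: finite_upper_maps finite_lower_maps simp: T_def)
  also have "\<dots> = (\<Sum>f\<in>upper_maps U V. q ^ card (upper_crossings U V f) *
           (\<Sum>g\<in>lower_maps (I - U) (T f). q ^ card (lower_crossings (I - U) g)))"
    by (simp only: power_add sum_distrib_left)
  also have "\<dots> = (\<Sum>f\<in>upper_maps U V. q ^ card (upper_crossings U V f) *
      ((\<Prod>c\<in>I - V. qnum q (card {d \<in> I - U. c < d} - card {z \<in> I - V. c < z})) *
         (\<Prod>r<card V - card U. qnum q (card V - card U - r))))"
    using sum_lower_maps_signed[OF UV[unfolded I_def], of _ q]
    by (intro sum.cong refl) (simp add: T_def I_def)
  also have "\<dots> = (\<Prod>u\<in>U. qnum q (card {v \<in> V. u \<le> v} - card {z \<in> U. u < z})) *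
      ((\<Prod>c\<in>I - V. qnum q (card {d \<in> I - U. c < d} - card {z \<in> I - V. c < z})) *
         (\<Prod>r<card V - card U. qnum q (card V - card U - r)))"
    by (simp only: sum_distrib_right[symmetric] sum_upper_maps[OF fin(2,3)])
  finally show ?thesis
    by (simp only: mult.assoc)
qed

subsection \<open>The involution on pairs of sets\<close>

text \<open>This is \<open>p\<^sub>i\<close> of the overview, kept in the integers;
  \<open>nat\<close> restores the truncated difference inside a \<open>q\<close>-integer.\<close>

definition excess :: "int set \<Rightarrow> int set \<Rightarrow> int \<Rightarrow> int" where
  "excess U V i = int (card {v \<in> V. i < v}) - int (card {z \<in> U. i < z})"

text \<open>Exchanging "both" with "neither" and fixing the two mixed cases means that new
  membership of \<open>i + 1\<close> is old non-membership of \<open>i\<close> in \<open>V\<close>.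
  So the new first set depends on \<open>V\<close> alone, and the new second set on \<open>U\<close>
  alone.\<close>

definition rot_exc :: "nat \<Rightarrow> int set \<Rightarrow> int set" where
  "rot_exc n V = insert 1 ((\<lambda>i. i + 1) ` ({1..<int n} - V))"

definition rot_val :: "nat \<Rightarrow> int set \<Rightarrow> int set" where
  "rot_val n U = insert (int n) {i \<in> {1..<int n}. i + 1 \<notin> U}"

lemma card_greater_compl:
  assumes "A \<subseteq> {1..int n}" "0 \<le> i" "i \<le> int n"
  shows "int (card {x \<in> {1..int n} - A. i < x}) = int n - i - int (card {a \<in> A. i < a})"
proof -
  define B where "B = {a \<in> A. i < a}"
  have eq: "{x \<in> {1..int n} - A. i < x} = {i<..int n} - B"
    using assms by (auto simp: B_def)
  have sub: "B \<subseteq> {i<..int n}"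
    using assms by (auto simp: B_def)
  then have "finite B"
    using finite_subset by blast
  then show ?thesis
    using card_Diff_subset[OF _ sub] card_mono[OF _ sub] assms(3)
    unfolding eq B_def[symmetric] by simp
qed

lemma card_greater_pred:
  fixes A :: "int set"
  assumes "finite A"
  shows "card {a \<in> A. i - 1 < a} = card {a \<in> A. i < a} + (if i \<in> A then 1 else 0)"
proof -
  have "i - 1 < a \<longleftrightarrow> a = i \<or> i < a" for a by linarith
  then have "{a \<in> A. i - 1 < a} = (if i \<in> A then insert i {a \<in> A. i < a} else {a \<in> A. i < a})"
    by auto
  with assms show ?thesis by simp
qed

section \<open>Invariance of the product under the involution\<close>

context
  fixes n :: nat and U V :: "int set"
  assumes n: "n \<ge> 1" and UV: "U \<subseteq> {1..int n}" "V \<subseteq> {1..int n}" and U1: "1 \<in> U" and Vn: "int n \<in> V"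
begin

lemma finite_sets: "finite U" "finite V"
  using UV finite_subset by auto

text \<open>The factor of \<open>u\<close> is indexed by \<open>i = u - 1\<close>: the excess there
  also subtracts \<open>u\<close> itself, whence the \<open>+ 1\<close>. The factor of
  \<open>u = 1\<close> stands alone as \<open>i = 0\<close>.\<close>

lemma prod_upper_eq:
  "(\<Prod>u\<in>U. qnum q (card {v \<in> V. u \<le> v} - card {z \<in> U. u < z})) =
   qnum q (nat (excess U V 0 + 1)) *
   (\<Prod>i\<in>{1..<int n}. if i + 1 \<in> U then qnum q (nat (excess U V i + 1)) else 1)"
proof -
  let ?h = "\<lambda>i. qnum q (nat (excess U V i + 1))"
  let ?K = "{i \<in> {1..<int n}. i + 1 \<in> U}"
  have "qnum q (card {v \<in> V. u \<le> v} - card {z \<in> U. u < z}) = ?h (u - 1)" if "u \<in> U" for u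
  proof -
    have "{v \<in> V. u \<le> v} = {v \<in> V. u - 1 < v}" by auto
    then have "excess U V (u - 1) + 1 = int (card {v \<in> V. u \<le> v}) - int (card {z \<in> U. u < z})"
      using card_greater_pred[OF finite_sets(1), of u] that by (simp add: excess_def)
    then have "nat (excess U V (u - 1) + 1) = card {v \<in> V. u \<le> v} - card {z \<in> U. u < z}"
      by linarith
    then show ?thesis by simp
  qed
  then have "(\<Prod>u\<in>U. qnum q (card {v \<in> V. u \<le> v} - card {z \<in> U. u < z})) = (\<Prod>u\<in>U. ?h (u - 1))"
    by (rule prod.cong[OF refl])
  also have "\<dots> = (\<Prod>i\<in>insert 0 ?K. ?h i)"
    by (rule prod.reindex_bij_witness[where i = "\<lambda>i. i + 1" and j = "\<lambda>u. u - 1"])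
      (use UV U1 in force)+
  also have "finite ?K"
    by (rule finite_subset[of _ "{1..<int n}"]) auto
  then have "(\<Prod>i\<in>insert 0 ?K. ?h i) = ?h 0 * (\<Prod>i\<in>?K. ?h i)"
    by (rule prod.insert) simp
  also have "(\<Prod>i\<in>?K. ?h i) = (\<Prod>i\<in>{1..<int n}. if i + 1 \<in> U then ?h i else 1)"
    by (rule prod.inter_filter) simp
  finally show ?thesis .
qed

text \<open>Passing to complements in \<open>{1..int n}\<close> swaps the roles of \<open>U\<close>
  and \<open>V\<close> in the difference, which leaves exactly the excess at
  \<open>c\<close>.\<close>

lemma prod_lower_eq:
  "(\<Prod>c\<in>{1..int n} - V. qnum q (card {d \<in> {1..int n} - U. c < d} -
      card {z \<in> {1..int n} - V. c < z})) =
   (\<Prod>i\<in>{1..<int n}. if i \<in> V then 1 else qnum q (nat (excess U V i)))"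
proof -
  let ?h = "\<lambda>i. qnum q (nat (excess U V i))"
  have eq: "{1..int n} - V = {i \<in> {1..<int n}. i \<notin> V}"
    using Vn by (auto simp: order.order_iff_strict)
  have "qnum q (card {d \<in> {1..int n} - U. c < d} - card {z \<in> {1..int n} - V. c < z}) = ?h c"
    if "c \<in> {1..int n} - V" for c
  proof -
    have "nat (excess U V c) = card {d \<in> {1..int n} - U. c < d} - card {z \<in> {1..int n} - V. c < z}"
      using card_greater_compl[OF UV(1), of c] card_greater_compl[OF UV(2), of c] that
      unfolding excess_def by simp
    then show ?thesis by simp
  qed
  then have "(\<Prod>c\<in>{1..int n} - V. qnum q (card {d \<in> {1..int n} - U. c < d} -
      card {z \<in> {1..int n} - V. c < z})) = (\<Prod>c\<in>{1..int n} - V. ?h c)"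
    by (rule prod.cong[OF refl])
  also have "\<dots> = (\<Prod>i\<in>{1..<int n}. if i \<notin> V then ?h i else 1)"
    unfolding eq by (rule prod.inter_filter) simp
  also have "\<dots> = (\<Prod>i\<in>{1..<int n}. if i \<in> V then 1 else ?h i)"
    by (rule prod.cong) simp_all
  finally show ?thesis .
qed

lemma rot_subset: "rot_exc n V \<subseteq> {1..int n}" "rot_val n U \<subseteq> {1..int n}"
  and rot_ends: "1 \<in> rot_exc n V" "int n \<in> rot_val n U"
  using n by (auto simp: rot_exc_def rot_val_def)

lemma mem_rot:
  assumes "i \<in> {1..<int n}"
  shows "i + 1 \<in> rot_exc n V \<longleftrightarrow> i \<notin> V" "i \<in> rot_val n U \<longleftrightarrow> i + 1 \<notin> U"
  using assms by (auto simp: rot_exc_def rot_val_def)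

lemma rot_rot: "rot_exc n (rot_val n U) = U" "rot_val n (rot_exc n V) = V"
proof -
  show "rot_exc n (rot_val n U) = U"
  proof (intro equalityI subsetI)
    fix u assume u: "u \<in> U"
    show "u \<in> rot_exc n (rot_val n U)"
    proof (cases "u = 1")
      case False
      with u UV have "u - 1 \<in> {1..<int n} - rot_val n U"
        by (force simp: rot_val_def)
      then have "u - 1 + 1 \<in> rot_exc n (rot_val n U)"
        unfolding rot_exc_def by blast
      then show ?thesis by simp
    qed (simp add: rot_exc_def)
  qed (use U1 in \<open>auto simp: rot_exc_def rot_val_def\<close>)
  show "rot_val n (rot_exc n V) = V"
    using Vn UV by (force simp: rot_exc_def rot_val_def)
qed

text \<open>Besides \<open>int n\<close>, the elements above \<open>i\<close> are the predecessors
  of the non-members of \<open>U\<close> above \<open>i + 1\<close>.\<close>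

lemma card_rot_val_greater:
  assumes "0 \<le> i" "i < int n"
  shows "int (card {v \<in> rot_val n U. i < v}) = int n - i - int (card {z \<in> U. i + 1 < z})"
proof -
  let ?X = "{x \<in> {1..int n} - U. i + 1 < x}"
  have "{v \<in> rot_val n U. i < v} = insert (int n) ((\<lambda>x. x - 1) ` ?X)"
  proof (intro equalityI subsetI)
    fix v assume v: "v \<in> {v \<in> rot_val n U. i < v}"
    show "v \<in> insert (int n) ((\<lambda>x. x - 1) ` ?X)"
    proof (cases "v = int n")
      case False
      with v assms have "v + 1 \<in> ?X" by (auto simp: rot_val_def)
      then have "v + 1 - 1 \<in> (\<lambda>x. x - 1) ` ?X" by blast
      then show ?thesis by simp
    qed simp
  qed (use assms in \<open>auto simp: rot_val_def\<close>)
  moreover have "int n \<notin> (\<lambda>x. x - 1) ` ?X" by auto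
  moreover have "finite ?X"
    by (rule finite_subset[of _ "{1..int n}"]) auto
  ultimately have "card {v \<in> rot_val n U. i < v} = Suc (card ?X)"
    by (simp only: card_insert_disjoint finite_imageI card_image inj_on_diff_right simp_thms not_False_eq_True)
  then show ?thesis
    using card_greater_compl[OF UV(1), of "i + 1"] assms by simp
qed

lemma card_rot_exc_greater:
  assumes "1 \<le> i" "i < int n"
  shows "int (card {z \<in> rot_exc n V. i < z}) = int n - (i - 1) - int (card {v \<in> V. i - 1 < v})"
proof -
  let ?X = "{x \<in> {1..int n} - V. i - 1 < x}"
  have "{z \<in> rot_exc n V. i < z} = (\<lambda>x. x + 1) ` ?X"
    using assms Vn by (auto simp: rot_exc_def order.order_iff_strict)
  then have "card {z \<in> rot_exc n V. i < z} = card ?X"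
    by (simp add: card_image)
  then show ?thesis
    using card_greater_compl[OF UV(2), of "i - 1"] assms by simp
qed

lemma card_rot: "card (rot_exc n V) = n + 1 - card V" "card (rot_val n U) = n + 1 - card U"
proof -
  have "{1..<int n} - V = {1..int n} - V"
    using Vn by (auto simp: order.order_iff_strict)
  then have "card ({1..<int n} - V) = n - card V"
    using UV finite_sets by (simp add: card_Diff_subset)
  moreover have "1 \<notin> (\<lambda>i. i + 1) ` ({1..<int n} - V)" by auto
  moreover have "card V \<le> n"
    using card_mono[OF _ UV(2)] by simp
  ultimately show "card (rot_exc n V) = n + 1 - card V"
    by (simp add: rot_exc_def card_image)
  have "{v \<in> rot_val n U. 0 < v} = rot_val n U" "{z \<in> U. 1 - 1 < z} = U"
    using rot_subset(2) UV(1) by force+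
  moreover have "card U \<le> n"
    using card_mono[OF _ UV(1)] by simp
  ultimately show "card (rot_val n U) = n + 1 - card U"
    using card_rot_val_greater[of 0] n card_greater_pred[OF finite_sets(1), of 1] U1 by simp
qed

lemma excess_zero: "excess U V 0 = int (card V) - int (card U)"
proof -
  have "{v \<in> V. 0 < v} = V" "{z \<in> U. 0 < z} = U"
    using UV by force+
  then show ?thesis by (simp add: excess_def)
qed

lemma excess_rot:
  assumes "i \<in> {1..<int n}"
  shows "excess (rot_exc n V) (rot_val n U) i =
         excess U V i - 1 + (if i \<in> V then 1 else 0) + (if i + 1 \<in> U then 1 else 0)"
  using card_rot_val_greater[of i] card_rot_exc_greater[of i] assms
    card_greater_pred[OF finite_sets(2), of i] card_greater_pred[OF finite_sets(1), of "i + 1"]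
  by (simp add: excess_def)

end

text \<open>The equality holds for each \<open>i\<close> separately. When both memberships hold, the
  excess rises by one and \<open>[p + 1]\<close> moves from the upper to the lower product; when
  neither holds, the reverse happens; in the mixed cases nothing changes.\<close>

lemma prod_rot:
  fixes n :: nat and U V :: "int set" and q :: "'a::comm_semiring_1"
  assumes "n \<ge> 1" "U \<subseteq> {1..int n}" "V \<subseteq> {1..int n}" "1 \<in> U" "int n \<in> V"
  defines "P \<equiv> \<lambda>U V. (\<Prod>u\<in>U. qnum q (card {v \<in> V. u \<le> v} - card {z \<in> U. u < z})) *
      (\<Prod>c\<in>{1..int n} - V. qnum q (card {d \<in> {1..int n} - U. c < d} -
         card {z \<in> {1..int n} - V. c < z}))"
  shows "P (rot_exc n V) (rot_val n U) = P U V"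
proof -
  note A = assms(1-5)
  let ?U = "rot_exc n V" and ?V = "rot_val n U"
  note B = A(1) rot_subset[OF A] rot_ends[OF A]
  let ?f = "\<lambda>U V i. (if i + 1 \<in> U then qnum q (nat (excess U V i + 1)) else 1) *
      (if i \<in> V then 1 else qnum q (nat (excess U V i)))"
  have le: "card U \<le> n" "card V \<le> n"
    using card_mono[OF _ A(2)] card_mono[OF _ A(3)] by simp_all
  have "excess ?U ?V 0 = excess U V 0"
    unfolding excess_zero[OF A] excess_zero[OF B] card_rot[OF A] using le by simp
  moreover have "?f ?U ?V i = ?f U V i" if "i \<in> {1..<int n}" for i
    unfolding mem_rot[OF A that] excess_rot[OF A that] by (simp add: mult.commute)
  ultimately show ?thesis
    unfolding P_def prod_upper_eq[OF A] prod_lower_eq[OF A] prod_upper_eq[OF B] prod_lower_eq[OF B]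
      mult.assoc prod.distrib[symmetric] by simp
qed

subsection \<open>Flipping the sign of the first letter\<close>

definition flip_one :: "(int \<Rightarrow> int) \<Rightarrow> int \<Rightarrow> int" where
  "flip_one \<pi> i = (if \<bar>i\<bar> = 1 then - \<pi> i else \<pi> i)"

lemma flip_one_flip_one [simp]: "flip_one (flip_one \<pi>) = \<pi>"
  by (auto simp: flip_one_def)

lemma flip_one_one [simp]: "flip_one \<pi> 1 = - \<pi> 1"
  by (simp add: flip_one_def)

lemma flip_one_signed_perm:
  assumes n: "n \<ge> 1" and \<pi>: "\<pi> \<in> signed_perms n"
  shows "flip_one \<pi> \<in> signed_perms n"
  unfolding signed_perms_iff
proof (intro conjI allI impI)
  show "flip_one \<pi> (- i) = - flip_one \<pi> i" for i
    using signed_perm_odd[OF \<pi>] by (simp add: flip_one_def)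
  show "flip_one \<pi> i = i" if "\<bar>i\<bar> \<notin> {1..int n}" for i
    using signed_perm_id[OF \<pi> that] that n by (auto simp: flip_one_def)
  have "\<bar>flip_one \<pi> i\<bar> = \<bar>\<pi> i\<bar>" for i
    by (simp add: flip_one_def)
  then show "(\<lambda>i. \<bar>flip_one \<pi> i\<bar>) ` {1..int n} = {1..int n}"
    by (simp only: signed_perm_abs_image[OF \<pi>])
qed

context
  fixes n :: nat and \<pi> :: "int \<Rightarrow> int"
  assumes n: "n \<ge> 1" and \<pi>: "\<pi> \<in> signed_perms n" and pos: "\<pi> 1 > 0"
begin

lemma neg_flip_one: "neg n (flip_one \<pi>) = neg n \<pi> + 1"
proof -
  have "{i \<in> {1..int n}. flip_one \<pi> i < 0} = insert 1 {i \<in> {1..int n}. \<pi> i < 0}"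
    using n pos by (auto simp: flip_one_def)
  moreover have "finite {i \<in> {1..int n}. \<pi> i < 0}"
    by (rule finite_subset[of _ "{1..int n}"]) auto
  ultimately show ?thesis
    using pos by (simp add: neg_def)
qed

lemma wex_flip_one: "wex n \<pi> = wex n (flip_one \<pi>) + 1"
proof -
  have "{i \<in> {1..int n}. i \<le> \<pi> i} = insert 1 {i \<in> {1..int n}. i \<le> flip_one \<pi> i}"
    using n pos by (auto simp: flip_one_def)
  moreover have "finite {i \<in> {1..int n}. i \<le> flip_one \<pi> i}"
    by (rule finite_subset[of _ "{1..int n}"]) auto
  ultimately show ?thesis
    using pos by (simp add: wex_def)
qed

text \<open>The crossing pairs themselves stay the same: for \<open>j > 1\<close> a crossing
  \<open>(1, j)\<close> passes from the first kind to the second, and for \<open>i > 1\<close> a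
  crossing \<open>(i, 1)\<close> from the second to the third.\<close>

lemma cro_flip_one: "cro n (flip_one \<pi>) = cro n \<pi>"
proof -
  have "(i, j) \<in> crossings n (flip_one \<pi>) \<longleftrightarrow> (i, j) \<in> crossings n \<pi>" for i j
  proof (cases "i \<in> {1..int n} \<and> j \<in> {1..int n}")
    case True
    then have "\<pi> i \<noteq> 0" "\<pi> j \<noteq> 0"
      using signed_perm_nonzero[OF \<pi>] by blast+
    with True pos show ?thesis
      by (cases "i = 1"; cases "j = 1") (auto simp: crossings_def flip_one_def)
  qed (auto simp: crossings_def)
  then show ?thesis
    unfolding cro_def by (metis subrelI subset_antisym)
qed

end

section \<open>The sum over words with positive first letter, and its symmetry\<close>

definition pos_first_poly :: "nat \<Rightarrow> nat \<Rightarrow> int poly poly" where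
  "pos_first_poly n k =
     (\<Sum>\<pi> | \<pi> \<in> signed_perms n \<and> \<pi> 1 > 0 \<and> fwex n \<pi> = k. monom (monom 1 (cro n \<pi>)) (neg n \<pi> + 1))"

text \<open>Making a negative first letter positive raises \<open>fwex\<close> by one. It lowers
  \<open>neg\<close> by one, which the indicator of a positive first letter offsets, so the power of
  \<open>t\<close> is unchanged.\<close>

lemma B_star_poly_eq:
  assumes n: "n \<ge> 1"
  shows "B_star_poly n k = pos_first_poly n k + pos_first_poly n (k + 1)"
proof -
  let ?m = "\<lambda>\<pi>. monom (monom 1 (cro n \<pi>)) (neg n \<pi> + (if \<pi> 1 > 0 then 1 else 0)) :: int poly poly"
  let ?A = "{\<pi>. \<pi> \<in> signed_perms n \<and> \<pi> 1 > 0 \<and> fwex n \<pi> = k}"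
  let ?B = "{\<pi>. \<pi> \<in> signed_perms n \<and> \<pi> 1 < 0 \<and> fwex n \<pi> = k}"
  have nz: "\<pi> 1 \<noteq> 0" if "\<pi> \<in> signed_perms n" for \<pi>
    using signed_perm_nonzero[OF that, of 1] n by simp
  have "{\<pi> \<in> signed_perms n. fwex n \<pi> = k} = ?A \<union> ?B"
    using nz by fastforce
  then have "B_star_poly n k = sum ?m (?A \<union> ?B)"
    by (simp only: B_star_poly_def)
  also have "\<dots> = sum ?m ?A + sum ?m ?B"
    by (rule sum.union_disjoint) (auto intro: finite_subset[OF _ finite_signed_perms[of n]])
  also have "sum ?m ?A = pos_first_poly n k"
    unfolding pos_first_poly_def by (rule sum.cong) auto
  also have "sum ?m ?B = pos_first_poly n (k + 1)"
    unfolding pos_first_poly_def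
  proof (rule sum.reindex_bij_witness[where i = flip_one and j = flip_one], goal_cases)
    case (2 \<pi>)
    then have f: "flip_one \<pi> \<in> signed_perms n" "flip_one \<pi> 1 > 0"
      using flip_one_signed_perm[OF n] by auto
    show ?case
      using 2 f neg_flip_one[OF n f] wex_flip_one[OF n f] by (simp add: fwex_def)
  next
    case (4 \<pi>)
    then have f: "\<pi> \<in> signed_perms n" "\<pi> 1 > 0"
      by auto
    show ?case
      using 4 flip_one_signed_perm[OF n f(1)] neg_flip_one[OF n f] wex_flip_one[OF n f]
      by (simp add: fwex_def)
  next
    case (5 \<pi>)
    then have f: "flip_one \<pi> \<in> signed_perms n" "flip_one \<pi> 1 > 0"
      using flip_one_signed_perm[OF n] by auto
    show ?case
      using 5 neg_flip_one[OF n f] cro_flip_one[OF n f] by simp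
  qed simp_all
  finally show ?thesis .
qed

lemma pos_first_poly_eq:
  assumes n: "n \<ge> 1"
  shows "pos_first_poly n k =
    (\<Sum>(U, V) | U \<subseteq> {1..int n} \<and> V \<subseteq> {1..int n} \<and> 1 \<in> U \<and> int n \<in> V \<and> card U + card V = k.
       monom (\<Sum>\<pi> | \<pi> \<in> signed_perms n \<and> exc_set n \<pi> = U \<and> val_set n \<pi> = V. monom 1 1 ^ cro n \<pi>)
         (card V - card U + 1))"
    (is "_ = (\<Sum>(U, V) | ?Q U V. _)")
proof -
  let ?A = "{\<pi>. \<pi> \<in> signed_perms n \<and> \<pi> 1 > 0 \<and> fwex n \<pi> = k}"
  let ?F = "\<lambda>U V. {\<pi>. \<pi> \<in> signed_perms n \<and> exc_set n \<pi> = U \<and> val_set n \<pi> = V}"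
  let ?g = "\<lambda>\<pi>. (exc_set n \<pi>, val_set n \<pi>)"
  let ?m = "\<lambda>\<pi>. monom (monom 1 (cro n \<pi>)) (neg n \<pi> + 1) :: int poly poly"
  have card: "card (exc_set n \<pi>) = wex n \<pi>" "card (val_set n \<pi>) = wex n \<pi> + neg n \<pi>"
    "fwex n \<pi> = card (exc_set n \<pi>) + card (val_set n \<pi>)"
    if "\<pi> \<in> signed_perms n" for \<pi>
    using card_val_set[OF that] by (simp_all add: exc_set_def wex_def fwex_def)
  have finA: "finite ?A"
    by (rule finite_subset[OF _ finite_signed_perms[of n]]) auto
  have finQ: "finite {(U, V). ?Q U V}"
    by (rule finite_subset[of _ "Pow {1..int n} \<times> Pow {1..int n}"]) auto
  have sub: "?g ` ?A \<subseteq> {(U, V). ?Q U V}"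
  proof clarsimp
    fix \<pi> assume \<pi>: "\<pi> \<in> signed_perms n" "0 < \<pi> 1" "k = fwex n \<pi>"
    \<comment> \<open>A letter at a position that is not a weak exceedance is smaller than its
      position, so it cannot be \<open>n\<close>.\<close>
    have "int n \<in> val_set n \<pi>"
      using n by (auto simp: val_set_def exc_set_def)
    then show "exc_set n \<pi> \<subseteq> {1..int n} \<and> val_set n \<pi> \<subseteq> {1..int n} \<and> 1 \<in> exc_set n \<pi> \<and>
        int n \<in> val_set n \<pi> \<and> card (exc_set n \<pi>) + card (val_set n \<pi>) = fwex n \<pi>"
      using \<pi> n card(3)[OF \<pi>(1)] by (auto simp: exc_set_def val_set_def)
  qed
  have "pos_first_poly n k = (\<Sum>p | case p of (U, V) \<Rightarrow> ?Q U V. \<Sum>\<pi> | \<pi> \<in> ?A \<and> ?g \<pi> = p. ?m \<pi>)"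
    unfolding pos_first_poly_def by (rule sum.group[OF finA finQ sub, symmetric])
  also have "\<dots> = (\<Sum>(U, V) | ?Q U V. monom (\<Sum>\<pi>\<in>?F U V. monom 1 1 ^ cro n \<pi>) (card V - card U + 1))"
  proof (rule sum.cong[OF refl], clarify)
    fix U V assume Q: "U \<subseteq> {1..int n}" "V \<subseteq> {1..int n}" "1 \<in> U" "int n \<in> V" "k = card U + card V"
    have "{\<pi>. \<pi> \<in> ?A \<and> ?g \<pi> = (U, V)} = ?F U V"
      using Q card(3) by (auto simp: exc_set_def)
    \<comment> \<open>Writing the power of \<open>q\<close> as
      \<open>monom 1 1 ^ cro n \<pi>\<close> fits \<open>sum_cro_fixed_sets\<close> with
      \<open>monom 1 1\<close> for \<open>q\<close>.\<close>
    moreover have "?m \<pi> = monom (monom 1 1 ^ cro n \<pi>) (card V - card U + 1)" if "\<pi> \<in> ?F U V" for \<pi>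
      using that card(1,2)[of \<pi>] by (auto simp: monom_power)
    ultimately show "(\<Sum>\<pi> | \<pi> \<in> {\<pi>. \<pi> \<in> signed_perms n \<and> \<pi> 1 > 0 \<and> fwex n \<pi> = card U + card V} \<and>
          ?g \<pi> = (U, V). ?m \<pi>) =
        monom (\<Sum>\<pi>\<in>?F U V. monom 1 1 ^ cro n \<pi>) (card V - card U + 1)"
      using Q(5) by (simp add: monom_sum)
  qed
  finally show ?thesis .
qed

text \<open>The involution serves as its own inverse in the reindexing. It preserves
  \<open>card V - card U\<close>, which fixes both the power of \<open>t\<close> and the
  \<open>q\<close>-factorial; \<open>prod_rot\<close> handles the other factors.\<close>

lemma pos_first_poly_symmetric:
  assumes n: "n \<ge> 1" and k: "k \<le> 2 * n + 2"
  shows "pos_first_poly n k = pos_first_poly n (2 * n + 2 - k)"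
  unfolding pos_first_poly_eq[OF n]
proof (rule sum.reindex_bij_witness[where
      i = "\<lambda>(U, V). (rot_exc n V, rot_val n U)" and j = "\<lambda>(U, V). (rot_exc n V, rot_val n U)"],
      goal_cases)
  case (1 p)
  then show ?case using rot_rot[OF n] by auto
next
  case (2 p)
  then obtain U V where p: "p = (U, V)" and A: "U \<subseteq> {1..int n}" "V \<subseteq> {1..int n}" "1 \<in> U" "int n \<in> V"
    and c: "card U + card V = k" by auto
  have "card U \<le> n" "card V \<le> n"
    using card_mono[OF _ A(1)] card_mono[OF _ A(2)] by simp_all
  then show ?case
    using p c k rot_subset[OF n A] rot_ends[OF n A] card_rot[OF n A] by auto
next
  case (3 p)
  then show ?case using rot_rot[OF n] by auto
next
  case (4 p)
  then obtain U V where p: "p = (U, V)" and A: "U \<subseteq> {1..int n}" "V \<subseteq> {1..int n}" "1 \<in> U" "int n \<in> V"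
    and c: "card U + card V = 2 * n + 2 - k" by auto
  have "card U \<le> n" "card V \<le> n"
    using card_mono[OF _ A(1)] card_mono[OF _ A(2)] by simp_all
  then show ?case
    using p c k rot_subset[OF n A] rot_ends[OF n A] card_rot[OF n A] by auto
next
  case (5 p)
  then obtain U V where p: "p = (U, V)" and A: "U \<subseteq> {1..int n}" "V \<subseteq> {1..int n}" "1 \<in> U" "int n \<in> V"
    by auto
  have "card U \<le> n" "card V \<le> n"
    using card_mono[OF _ A(1)] card_mono[OF _ A(2)] by simp_all
  then have "card (rot_val n U) - card (rot_exc n V) = card V - card U"
    unfolding card_rot[OF n A] by simp
  then show ?case
    unfolding p prod.case sum_cro_fixed_sets[OF A(1,2)] sum_cro_fixed_sets[OF rot_subset[OF n A]]
    using prod_rot[OF n A, of "monom 1 1 :: int poly"] by simp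
qed

theorem theorem1p3:
  fixes n k :: nat
  assumes "n \<ge> 1" and "1 \<le> k" and "k \<le> 2 * n"
  shows "B_star_poly n k = B_star_poly n (2 * n + 1 - k) \<and>
         poly (B_poly n k) 1 = poly (B_poly n (2 * n + 1 - k)) 1"
proof
  \<comment> \<open>The reflection sends \<open>k\<close> to \<open>(2 * n + 1 - k) + 1\<close> and
    \<open>k + 1\<close> to \<open>2 * n + 1 - k\<close>, so the two summands trade places.\<close>
  have "pos_first_poly n k = pos_first_poly n (2 * n + 1 - k + 1)"
    using pos_first_poly_symmetric[of n k] assms by (simp add: Suc_diff_le)
  moreover have "pos_first_poly n (k + 1) = pos_first_poly n (2 * n + 1 - k)"
    using pos_first_poly_symmetric[of n "k + 1"] assms by simp
  ultimately show star: "B_star_poly n k = B_star_poly n (2 * n + 1 - k)"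
    unfolding B_star_poly_eq[OF assms(1)] by (simp only: add.commute)
  \<comment> \<open>The two polynomials differ only in exponents of \<open>t\<close>, which are
    invisible at \<open>t = 1\<close>.\<close>
  have "poly (B_poly n j) 1 = poly (B_star_poly n j) 1" for j
    by (simp add: B_poly_def B_star_poly_def poly_sum poly_monom)
  then show "poly (B_poly n k) 1 = poly (B_poly n (2 * n + 1 - k)) 1"
    using star by simp
qed

end
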